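(* Let $\mathbf{c}=c_0c_1c_2\cdots\in\{0,1\}^{\infty}$ with $c_0=1$. Then $\mathbf{c}$ is ($0$-$1$) apwenian if and only if for all $n\geq 0$, \[c_n\equiv c_{2n+1}+c_{2n+2}\pmod 2.\]
   Context: For an integer sequence $\mathbf{a}$, $H_n(\mathbf{a})=\det(a_{i+j})_{0\leq i,j\leq n-1}$. A sequence $\mathbf{c}\in\{0,1\}^{\infty}$ is called ($0$-$1$) apwenian if $H_n(\mathbf{c})\equiv 1\pmod 2$ for all $n\geq 1$. *)

theory Defs
  imports "Jordan_Normal_Form.Determinant" "HOL-Number_Theory.Cong"
begin

definition hankel_det :: "nat \<Rightarrow> (nat \<Rightarrow> int) \<Rightarrow> int" where
  "hankel_det n a = det (mat n n (\<lambda>(i, j). a (i + j)))"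

definition zero_one_seq :: "(nat \<Rightarrow> int) \<Rightarrow> bool" where
  "zero_one_seq c \<longleftrightarrow> (\<forall>n. c n \<in> {0, 1})"

definition apwenian :: "(nat \<Rightarrow> int) \<Rightarrow> bool" where
  "apwenian c \<longleftrightarrow> zero_one_seq c \<and> (\<forall>n\<ge>1. [hankel_det n c = 1] (mod 2))"

end

theory Submission
  imports Defs "HOL-Library.Z2"
begin

text \<open>
  Work over the field with two elements and let \<open>L\<close> be the linear functional on polynomials
  with \<open>L(X\<^sup>n) = c\<^sub>n\<close>. Define monic polynomials by \<open>p\<^sub>k\<^sub>+\<^sub>1 = (X + a\<^sub>k) p\<^sub>k + p\<^sub>k\<^sub>-\<^sub>1\<close> with
  \<open>a\<^sub>k = L(X p\<^sub>k\<^sup>2)\<close>. As long as \<open>L(p\<^sub>k\<^sup>2) = 1\<close> they are orthogonal for \<open>L\<close>, so triangularising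
  the Hankel matrix shows that all its determinants are 1 iff \<open>L(p\<^sub>k\<^sup>2) = 1\<close> for all \<open>k\<close>.
  On the other hand, squaring is additive in characteristic 2, so the recurrence for \<open>c\<close> says
  \<open>L((X + X\<^sup>2) r\<^sup>2) = L(r)\<close> for all \<open>r\<close>, and it suffices to test this on the \<open>p\<^sub>k\<close>. There
  \<open>L(p\<^sub>k)\<close> vanishes unless \<open>k = 0\<close>, and squaring the three-term recurrence gives
  \<open>L((X + X\<^sup>2) p\<^sub>k\<^sup>2) = L(p\<^sub>k\<^sub>+\<^sub>1\<^sup>2) + L(p\<^sub>k\<^sub>-\<^sub>1\<^sup>2)\<close>, so both conditions agree by induction.
\<close>

section \<open>The linear functional with prescribed moments\<close>

definition moment_functional :: "(nat \<Rightarrow> 'a::comm_ring_1) \<Rightarrow> 'a poly \<Rightarrow> 'a" where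
  "moment_functional c p = (\<Sum>i\<le>degree p. coeff p i * c i)"

text \<open>Freedom in the upper bound gives polynomials of different degrees a common summation
  range, as additivity requires.\<close>

lemma moment_functional_altdef:
  assumes "degree p \<le> n"
  shows "moment_functional c p = (\<Sum>i\<le>n. coeff p i * c i)"
  unfolding moment_functional_def using assms
  by (intro sum.mono_neutral_left) (auto simp: coeff_eq_0)

lemma moment_functional_0 [simp]: "moment_functional c 0 = 0"
  by (simp add: moment_functional_def)

lemma moment_functional_add:
  "moment_functional c (p + q) = moment_functional c p + moment_functional c q"
proof -
  let ?n = "max (degree p) (degree q)"
  have "moment_functional c (p + q) = (\<Sum>i\<le>?n. coeff (p + q) i * c i)"
    by (rule moment_functional_altdef) (rule degree_add_le_max)
  also have "\<dots> = (\<Sum>i\<le>?n. coeff p i * c i) + (\<Sum>i\<le>?n. coeff q i * c i)"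
    by (simp add: distrib_right sum.distrib)
  finally show ?thesis
    by (simp add: moment_functional_altdef[where n = ?n])
qed

lemma moment_functional_smult:
  "moment_functional c (smult a p) = a * moment_functional c p"
  using moment_functional_altdef[OF degree_smult_le, of c a p]
  by (simp add: moment_functional_def sum_distrib_left mult.assoc)

lemma moment_functional_monom [simp]: "moment_functional c (monom a n) = a * c n"
proof -
  have "moment_functional c (monom a n) = (\<Sum>i\<le>n. coeff (monom a n) i * c i)"
    by (rule moment_functional_altdef) (rule degree_monom_le)
  also have "\<dots> = (\<Sum>i\<le>n. if i = n then a * c n else 0)"
    by (intro sum.cong) auto
  finally show ?thesis by simp
qed

lemma moment_functional_sum:
  "moment_functional c (\<Sum>i\<in>A. f i) = (\<Sum>i\<in>A. moment_functional c (f i))"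
  by (induction A rule: infinite_finite_induct) (simp_all add: moment_functional_add)

lemma poly_eq_sum_monom_upto:
  assumes "degree p < n"
  shows "p = (\<Sum>i<n. monom (coeff p i) i)"
  using assms by (intro poly_eqI) (auto simp: coeff_sum coeff_eq_0)

lemma moment_functional_mult:
  assumes "degree p < n" "degree q < n"
  shows "moment_functional c (p * q) = (\<Sum>i<n. \<Sum>j<n. coeff p i * c (i + j) * coeff q j)"
proof -
  have "p * q = (\<Sum>i<n. monom (coeff p i) i) * (\<Sum>j<n. monom (coeff q j) j)"
    using assms poly_eq_sum_monom_upto by metis
  also have "\<dots> = (\<Sum>i<n. \<Sum>j<n. monom (coeff p i * coeff q j) (i + j))"
    by (simp add: sum_product mult_monom)
  finally show ?thesis
    by (simp add: moment_functional_sum mult_ac)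
qed

text \<open>The unitriangular coefficient matrix \<open>P\<close> turns the Hankel matrix
  \<open>H\<close> into the Gram matrix \<open>D\<close>, equal to
  \<open>P * H * transpose_mat P\<close>, which orthogonality makes diagonal. As
  \<open>det P = 1\<close>, \<open>H\<close> and \<open>D\<close> have the same determinant.\<close>

lemma det_hankel_orthogonal:
  fixes c :: "nat \<Rightarrow> 'a::comm_ring_1"
  assumes deg: "\<And>k. k < n \<Longrightarrow> degree (p k) = k"
    and monic: "\<And>k. k < n \<Longrightarrow> coeff (p k) k = 1"
    and orth: "\<And>j k. j < n \<Longrightarrow> k < n \<Longrightarrow> j \<noteq> k \<Longrightarrow> moment_functional c (p j * p k) = 0"
  shows "det (mat n n (\<lambda>(i, j). c (i + j))) = (\<Prod>k<n. moment_functional c (p k * p k))"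
proof -
  define P where "P = mat n n (\<lambda>(i, j). coeff (p i) j)"
  define H where "H = mat n n (\<lambda>(i, j). c (i + j))"
  define D where "D = mat n n (\<lambda>(i, j). moment_functional c (p i * p j))"
  have carr [simp]: "P \<in> carrier_mat n n" "H \<in> carrier_mat n n" "D \<in> carrier_mat n n"
    by (simp_all add: P_def H_def D_def)
  have "det P = prod_list (diag_mat P)"
    by (rule det_lower_triangular[where n = n]) (auto simp: P_def coeff_eq_0 deg)
  also have "\<dots> = 1"
    unfolding prod_list_diag_prod by (simp add: P_def monic)
  finally have P: "det P = 1" .
  have "det D = prod_list (diag_mat D)"
    by (rule det_lower_triangular[where n = n]) (auto simp: D_def orth)
  also have "\<dots> = (\<Prod>k<n. moment_functional c (p k * p k))"
    unfolding prod_list_diag_prod by (simp add: D_def atLeast0LessThan)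
  finally have D: "det D = (\<Prod>k<n. moment_functional c (p k * p k))" .
  have "D = P * H * transpose_mat P"
  proof (rule eq_matI)
    fix i j assume "i < dim_row (P * H * transpose_mat P)" "j < dim_col (P * H * transpose_mat P)"
    then have ij: "i < n" "j < n" by (simp_all add: P_def)
    have "(P * H * transpose_mat P) $$ (i, j)
        = (\<Sum>l<n. (\<Sum>k<n. coeff (p i) k * c (k + l)) * coeff (p j) l)"
      using ij by (simp add: P_def H_def scalar_prod_def atLeast0LessThan)
    also have "\<dots> = (\<Sum>k<n. \<Sum>l<n. coeff (p i) k * c (k + l) * coeff (p j) l)"
      unfolding sum_distrib_right by (rule sum.swap)
    also have "\<dots> = moment_functional c (p i * p j)"
      using ij by (intro moment_functional_mult [symmetric]) (simp_all add: deg)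
    finally show "D $$ (i, j) = (P * H * transpose_mat P) $$ (i, j)"
      using ij by (simp add: D_def)
  qed (simp_all add: P_def D_def)
  moreover have "det (P * H * transpose_mat P) = det (P * H) * det (transpose_mat P)"
    by (rule det_mult[where n = n]) (auto intro!: mult_carrier_mat[where n = n])
  moreover have "det (P * H) = det P * det H"
    by (rule det_mult[OF carr(1,2)])
  ultimately have "det D = det P * det H * det (transpose_mat P)"
    by simp
  then show ?thesis
    using P D det_transpose[OF carr(1)] by (simp add: H_def)
qed

section \<open>Arithmetic over the field with two elements\<close>

declare add_bit_eq_xor [simp del] mult_bit_eq_and [simp del]

lemma bit_add_self [simp]: "(b::bit) + b = 0"
  by (cases b) simp_all

lemma bit_poly_add_self [simp]: "(p::bit poly) + p = 0"
  by (rule poly_eqI) (simp only: coeff_add bit_add_self coeff_0)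

lemma bit_poly_add_left_self [simp]: "(p::bit poly) + (p + q) = q"
  by (simp only: add.assoc[symmetric] bit_poly_add_self add_0_left)

lemma bit_poly_square_add: "((p::bit poly) + q) * (p + q) = p * p + q * q"
proof -
  have "(p + q) * (p + q) = p * p + q * q + (p * q + p * q)"
    by (simp only: distrib_left distrib_right ac_simps)
  then show ?thesis by (simp only: bit_poly_add_self add_0_right)
qed

lemma bit_of_int_eq_1_iff: "(of_int k :: bit) = 1 \<longleftrightarrow> [k = 1] (mod 2)"
proof (cases "even k")
  case True
  then show ?thesis by (auto simp: cong_def elim!: evenE)
next
  case False
  then show ?thesis by (auto simp: cong_def elim!: oddE)
qed

lemma bit_of_int_eq_iff: "(of_int k :: bit) = of_int l \<longleftrightarrow> [k = l] (mod 2)"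
proof -
  have "(of_int k :: bit) = of_int l \<longleftrightarrow> (of_int (k - l + 1) :: bit) = 1"
    by (simp del: minus_bit_def)
  also have "\<dots> \<longleftrightarrow> [k = l] (mod 2)"
    unfolding bit_of_int_eq_1_iff by (simp add: cong_iff_dvd_diff)
  finally show ?thesis .
qed

lemma of_int_hankel_det:
  "(of_int (hankel_det n c) :: 'a::comm_ring_1) = det (mat n n (\<lambda>(i, j). of_int (c (i + j))))"
  unfolding hankel_det_def of_int_hom.hom_det[symmetric]
  by (rule arg_cong[where f = det]) (auto intro!: eq_matI)

section \<open>Orthogonal polynomials over the field with two elements\<close>

abbreviation X :: "'a::comm_ring_1 poly" where
  "X \<equiv> monom 1 (Suc 0)"

text \<open>Indices are shifted by one: \<open>orth_poly c (Suc k)\<close> has degree \<open>k\<close>, and index 0 stands for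
  the zero polynomial, so that the three-term recurrence needs no special first step.\<close>

fun orth_poly :: "(nat \<Rightarrow> bit) \<Rightarrow> nat \<Rightarrow> bit poly" where
  "orth_poly c 0 = 0"
| "orth_poly c (Suc 0) = 1"
| "orth_poly c (Suc (Suc n)) =
     X * orth_poly c (Suc n)
     + (smult (moment_functional c (X * (orth_poly c (Suc n) * orth_poly c (Suc n)))) (orth_poly c (Suc n))
     + orth_poly c n)"

declare orth_poly.simps(3) [simp del]

context
  fixes c :: "nat \<Rightarrow> bit"
begin

private abbreviation L where "L \<equiv> moment_functional c"
private abbreviation Q where "Q \<equiv> orth_poly c"
private abbreviation A where "A n \<equiv> L (X * (Q n * Q n))"

lemma orth_poly_degree: "degree (Q (Suc n)) = n \<and> coeff (Q (Suc n)) n = 1"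
proof (induction n rule: less_induct)
  case (less n)
  show ?case
  proof (cases n)
    case 0
    then show ?thesis by simp
  next
    case (Suc m)
    let ?r = "smult (A (Suc m)) (Q (Suc m)) + Q m"
    have IH: "degree (Q (Suc m)) = m" "coeff (Q (Suc m)) m = 1"
      using less[of m] Suc by auto
    have lead: "degree (X * Q (Suc m)) = Suc m" "coeff (X * Q (Suc m)) (Suc m) = 1"
    proof -
      have "Q (Suc m) \<noteq> 0" using IH by auto
      then show "degree (X * Q (Suc m)) = Suc m"
        by (simp add: degree_mult_eq IH degree_monom_eq)
      show "coeff (X * Q (Suc m)) (Suc m) = 1"
        using IH coeff_monom_mult[of 1 "Suc 0" "Q (Suc m)" "Suc m"] by simp
    qed
    \<comment> \<open>For \<open>m = 0\<close> this is the zero polynomial \<open>Q 0\<close>, whose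
      degree is 0 by convention; otherwise the degree is \<open>m - 1\<close>.\<close>
    have "degree (Q m) \<le> m"
      using less[of "m - 1"] Suc by (cases m) auto
    then have "degree ?r \<le> m"
      using IH degree_smult_le[of "A (Suc m)" "Q (Suc m)"] by (intro degree_add_le) auto
    then have r: "degree ?r < Suc m" by simp
    then have "degree (X * Q (Suc m) + ?r) = Suc m"
      using degree_add_eq_left[of ?r "X * Q (Suc m)"] lead by simp
    moreover have "coeff (X * Q (Suc m) + ?r) (Suc m) = 1"
      unfolding coeff_add[of "X * Q (Suc m)"] coeff_eq_0[OF r] lead by simp
    ultimately show ?thesis unfolding Suc orth_poly.simps by blast
  qed
qed

lemma X_mult_orth_poly:
  assumes "n > 0"
  shows "X * Q n = Q (Suc n) + smult (A n) (Q n) + Q (n - 1)"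
proof -
  obtain m where n: "n = Suc m" using assms by (cases n) auto
  have "Q (Suc n) + smult (A n) (Q n) + Q (n - 1)
      = Q m + (Q m + (smult (A n) (Q n) + (smult (A n) (Q n) + X * Q n)))"
    unfolding n orth_poly.simps diff_Suc_1 by (simp only: ac_simps)
  then show ?thesis by (simp only: bit_poly_add_left_self)
qed

lemma moment_X_orth_poly:
  assumes "n > 0"
  shows "L (X * Q n * r) = L (Q (Suc n) * r) + A n * L (Q n * r) + L (Q (n - 1) * r)"
  unfolding X_mult_orth_poly[OF assms]
  by (simp only: distrib_right moment_functional_add mult_smult_left moment_functional_smult)

lemma moment_orth_poly_Suc:
  assumes "n > 0"
  shows "L (Q (Suc n) * r) = L (X * Q n * r) + A n * L (Q n * r) + L (Q (n - 1) * r)"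
  unfolding moment_X_orth_poly[OF assms]
  by (cases "L (Q (Suc n) * r)"; cases "A n * L (Q n * r)"; cases "L (Q (n - 1) * r)") simp_all

text \<open>Only the new index \<open>Suc (Suc n)\<close> needs work: expand that polynomial by the
  recurrence, then move the factor \<open>X\<close> over to \<open>Q i\<close> and expand again,
  which leaves products covered by the induction hypothesis or the norm assumption.\<close>

lemma orth_poly_orthogonal:
  assumes "\<And>j. 0 < j \<Longrightarrow> j \<le> n \<Longrightarrow> L (Q j * Q j) = 1" and "i < j" "j \<le> Suc n"
  shows "L (Q i * Q j) = 0"
  using assms
proof (induction n arbitrary: i j)
  case 0
  then have "i = 0" by simp
  then show ?case by simp
next
  case (Suc n)
  have IH: "L (Q i * Q j) = 0" if "i < j" "j \<le> Suc n" for i j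
    using Suc.IH[of i j] Suc.prems(1) that by auto
  show ?case
  proof (cases "j = Suc (Suc n) \<and> i > 0")
    case False
    then show ?thesis using IH[of i j] Suc.prems by (cases "i = 0") auto
  next
    case True
    then have j: "j = Suc (Suc n)" and i: "i > 0" "i \<le> Suc n" using Suc.prems by auto
    have "L (Q i * Q j) = L (X * Q (Suc n) * Q i) + A (Suc n) * L (Q (Suc n) * Q i) + L (Q n * Q i)"
      unfolding j using moment_orth_poly_Suc[of "Suc n" "Q i"]
      by (simp only: mult.commute[of "Q i"] diff_Suc_1 zero_less_Suc simp_thms)
    also have "\<dots> = 0"
    proof (cases "i = Suc n")
      \<comment> \<open>Here the definition of \<open>A\<close> pays off: since
        \<open>Q (Suc n)\<close> has norm 1, the value \<open>A (Suc n)\<close> occurs twice and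
        cancels.\<close>
      case True
      then show ?thesis
        using Suc.prems(1)[of "Suc n"] IH[of n "Suc n"] by (simp add: mult.assoc)
    next
      case False
      then have lt: "i < Suc n" using i by simp
      have "X * Q (Suc n) * Q i = X * Q i * Q (Suc n)" by (simp only: ac_simps)
      then have "L (X * Q (Suc n) * Q i)
          = L (Q (Suc i) * Q (Suc n)) + A i * L (Q i * Q (Suc n)) + L (Q (i - 1) * Q (Suc n))"
        using moment_X_orth_poly[OF i(1), of "Q (Suc n)"] by (simp only:)
      also have "\<dots> = L (Q (Suc i) * Q (Suc n))"
        using IH[of i "Suc n"] IH[of "i - 1" "Suc n"] lt by simp
      \<comment> \<open>For \<open>i = n\<close> both sides are norms, hence 1; this is why
        \<open>orth_poly c n\<close> enters the recurrence with coefficient 1. For smaller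
        \<open>i\<close> both sides vanish.\<close>
      also have "\<dots> = L (Q n * Q i)"
      proof (cases "i = n")
        case True
        then show ?thesis using Suc.prems(1)[of n] Suc.prems(1)[of "Suc n"] i by simp
      next
        case False
        then show ?thesis
          using IH[of "Suc i" "Suc n"] IH[of i n] lt by (simp add: mult.commute)
      qed
      finally show ?thesis using IH[OF lt] by (simp add: mult.commute)
    qed
    finally show ?thesis .
  qed
qed

text \<open>Orthogonality up to index \<open>n\<close> uses only the norms below \<open>n\<close>,
  so the last factor of the product, the norm of \<open>Q n\<close>, is left unconstrained and can
  be read off from the determinant.\<close>

lemma det_hankel_orth_poly:
  assumes "\<And>j. 0 < j \<Longrightarrow> j < n \<Longrightarrow> L (Q j * Q j) = 1"
  shows "det (mat n n (\<lambda>(i, j). c (i + j))) = (\<Prod>k<n. L (Q (Suc k) * Q (Suc k)))"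
proof (rule det_hankel_orthogonal)
  fix j k assume jk: "j < n" "k < n" "j \<noteq> k"
  have "L (Q (Suc j) * Q (Suc k)) = 0" if "j < k" "k < n" for j k
    using orth_poly_orthogonal[of "n - 1" "Suc j" "Suc k"] assms that by auto
  from this[of j k] this[of k j] show "L (Q (Suc j) * Q (Suc k)) = 0"
    using jk by (cases "j < k") (simp_all add: mult.commute)
qed (simp_all add: orth_poly_degree)

lemma all_hankel_dets_1_iff:
  "(\<forall>n\<ge>1. det (mat n n (\<lambda>(i, j). c (i + j))) = 1) \<longleftrightarrow> (\<forall>n>0. L (Q n * Q n) = 1)"
proof
  assume det: "\<forall>n\<ge>1. det (mat n n (\<lambda>(i, j). c (i + j))) = 1"
  have "L (Q n * Q n) = 1" if "n > 0" for n
    using that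
  proof (induction n rule: less_induct)
    case (less n)
    obtain m where n: "n = Suc m" using less.prems by (cases n) auto
    \<comment> \<open>By the induction hypothesis every factor but the last is 1.\<close>
    have "1 = (\<Prod>k<n. L (Q (Suc k) * Q (Suc k)))"
      using det_hankel_orth_poly[of n] det less by auto
    also have "\<dots> = L (Q n * Q n)"
      using less.IH unfolding n by simp
    finally show ?case by simp
  qed
  then show "\<forall>n>0. L (Q n * Q n) = 1" by blast
qed (simp add: det_hankel_orth_poly)

section \<open>The recurrence as an identity for squares\<close>

lemma moment_square_orth_poly:
  assumes "n > 0" and "L (Q n * Q n) = 1"
  shows "L ((X + X * X) * (Q n * Q n)) = L (Q (Suc n) * Q (Suc n)) + L (Q (n - 1) * Q (n - 1))"
proof -
  have "(X * Q n) * (X * Q n) = Q (Suc n) * Q (Suc n) + smult (A n * A n) (Q n * Q n) + Q (n - 1) * Q (n - 1)"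
    unfolding X_mult_orth_poly[OF assms(1)] bit_poly_square_add
    by (simp only: mult_smult_left mult_smult_right smult_smult)
  then have "L ((X * Q n) * (X * Q n)) = L (Q (Suc n) * Q (Suc n)) + A n * A n + L (Q (n - 1) * Q (n - 1))"
    by (simp only: moment_functional_add moment_functional_smult assms mult_1_right)
  moreover have "(X + X * X) * (Q n * Q n) = X * (Q n * Q n) + (X * Q n) * (X * Q n)"
    unfolding distrib_right by (simp only: mult_ac)
  ultimately have "L ((X + X * X) * (Q n * Q n))
      = A n + (L (Q (Suc n) * Q (Suc n)) + A n * A n + L (Q (n - 1) * Q (n - 1)))"
    by (simp only: moment_functional_add)
  \<comment> \<open>Elements of the field are idempotent, so
    \<open>A n + A n * A n = 0\<close>.\<close>
  then show ?thesis
    by (cases "A n"; cases "L (Q (Suc n) * Q (Suc n))"; cases "L (Q (n - 1) * Q (n - 1))") simp_all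
qed

lemma moment_square_additive:
  assumes "L ((X + X * X) * (p * p)) = L p" "L ((X + X * X) * (q * q)) = L q"
  shows "L ((X + X * X) * ((p + q) * (p + q))) = L (p + q)"
  using assms unfolding bit_poly_square_add
  by (simp only: distrib_left[of "X + X * X"] moment_functional_add)

lemma moment_square_monom:
  "L ((X + X * X) * (monom 1 n * monom 1 n)) = c (2 * n + 1) + c (2 * n + 2)"
  by (simp add: mult_monom distrib_right moment_functional_add mult_2)

text \<open>On the monomial of degree \<open>n\<close> the right-hand identity is exactly the
  recurrence at \<open>n\<close>. Both of its sides are additive in \<open>p\<close>, so monomials
  suffice.\<close>

lemma recurrence_iff_moment_square:
  "(\<forall>n. c n = c (2 * n + 1) + c (2 * n + 2)) \<longleftrightarrow> (\<forall>p. L ((X + X * X) * (p * p)) = L p)"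
proof
  assume rec: "\<forall>n. c n = c (2 * n + 1) + c (2 * n + 2)"
  have "L ((X + X * X) * (p * p)) = L p" for p
  proof -
    define S where "S n = (\<Sum>i<n. monom (coeff p i) i)" for n
    have "L ((X + X * X) * (S n * S n)) = L (S n)" for n
    proof (induction n)
      case (Suc n)
      have "L ((X + X * X) * (monom b n * monom b n)) = L (monom b n)" for b
      proof (cases "b = 0")
        case False
        then have "b = 1" by simp
        then show ?thesis
          by (simp only: moment_square_monom rec[rule_format, symmetric] moment_functional_monom mult_1_left)
      qed simp
      from moment_square_additive[OF Suc this] show ?case by (simp add: S_def)
    qed (simp add: S_def)
    moreover have "S (Suc (degree p)) = p"
      unfolding S_def by (rule poly_eq_sum_monom_upto [symmetric]) simp
    ultimately show ?thesis by metis
  qed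
  then show "\<forall>p. L ((X + X * X) * (p * p)) = L p" by blast
next
  assume "\<forall>p. L ((X + X * X) * (p * p)) = L p"
  then show "\<forall>n. c n = c (2 * n + 1) + c (2 * n + 2)"
    using moment_square_monom by (metis moment_functional_monom mult_1_left)
qed

text \<open>The \<open>Q n\<close> with \<open>n > 0\<close> contain one monic polynomial of each
  degree. Adding the one of the degree of \<open>p\<close> cancels the leading term of
  \<open>p\<close>, and adding it again recovers \<open>p\<close>.\<close>

lemma moment_square_if_orth_poly:
  assumes "\<And>n. n > 0 \<Longrightarrow> L ((X + X * X) * (Q n * Q n)) = L (Q n)"
  shows "L ((X + X * X) * (p * p)) = L p"
proof (induction "degree p" arbitrary: p rule: less_induct)
  case less
  let ?q = "Q (Suc (degree p))"
  have q: "degree ?q = degree p" "coeff ?q (degree p) = 1"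
    by (simp_all add: orth_poly_degree)
  have "L ((X + X * X) * ((p + ?q) * (p + ?q))) = L (p + ?q)" if "p \<noteq> 0"
  \<comment> \<open>A nonzero constant is 1, so the sum is the zero polynomial; its degree is again
    0 and the induction hypothesis would not apply.\<close>
  proof (cases "degree p = 0")
    case True
    then obtain b where "p = [:b:]" by (rule degree_eq_zeroE)
    then have "p = 1" using that by (cases b) (auto simp: one_pCons)
    then show ?thesis by (simp add: bit_poly_add_self)
  next
    case False
    have "coeff p (degree p) = 1" using that by (metis bit_not_zero_iff leading_coeff_0_iff)
    then have "coeff (p + ?q) (degree p) = 0" using q by (simp only: coeff_add bit_add_self)
    moreover have "degree (p + ?q) \<le> degree p" using q by (intro degree_add_le) auto
    ultimately have "degree (p + ?q) < degree p"
      using False by (metis degree_0 le_neq_implies_less leading_coeff_0_iff bot_nat_0.not_eq_extremum)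
    then show ?thesis by (rule less)
  qed
  from moment_square_additive[OF this assms[of "Suc (degree p)"]]
  show ?case
    by (cases "p = 0") (simp_all only: add.assoc bit_poly_add_self add_0_right
      mult_zero_left mult_zero_right moment_functional_0 zero_less_Suc simp_thms)
qed

lemma hankel_dets_1_iff_recurrence:
  assumes c0: "c 0 = 1"
  shows "(\<forall>n\<ge>1. det (mat n n (\<lambda>(i, j). c (i + j))) = 1)
    \<longleftrightarrow> (\<forall>n. c n = c (2 * n + 1) + c (2 * n + 2))"
  unfolding all_hankel_dets_1_iff recurrence_iff_moment_square
proof
  have Q1: "L (Q 1 * Q 1) = 1"
    using c0 moment_functional_monom[of c 1 0] by (simp add: monom_0 one_pCons)
  {
    assume norm: "\<forall>n>0. L (Q n * Q n) = 1"
    have "L ((X + X * X) * (Q n * Q n)) = L (Q n)" if "n > 0" for n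
    \<comment> \<open>The neighbours \<open>Q 0\<close> and \<open>Q 2\<close> of \<open>Q 1\<close>
      have norms 0 and 1, matching \<open>L (Q 1) = c 0 = 1\<close>. For larger \<open>n\<close>
      both neighbouring norms are 1 and sum to 0.\<close>
    proof (cases "n = 1")
      case True
      have "L (Q (Suc 1) * Q (Suc 1)) = 1" using norm by blast
      then have "L ((X + X * X) * (Q 1 * Q 1)) = 1"
        using moment_square_orth_poly[of 1] Q1 by simp
      then show ?thesis using True Q1 by simp
    next
      case False
      \<comment> \<open>As \<open>Q 1 = 1\<close>, this says that \<open>L (Q n)\<close>
        vanishes.\<close>
      then have "L (Q 1 * Q n) = 0"
        using norm that by (intro orth_poly_orthogonal[of n]) auto
      then show ?thesis using moment_square_orth_poly[of n] norm that False by simp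
    qed
    then show "\<forall>p. L ((X + X * X) * (p * p)) = L p"
      using moment_square_if_orth_poly by blast
  }
  assume sq: "\<forall>p. L ((X + X * X) * (p * p)) = L p"
  have "L (Q n * Q n) = 1" if "n > 0" for n
    using that
  proof (induction n rule: less_induct)
    case (less n)
    show ?case
    proof (cases "n = 1")
      case True
      then show ?thesis using Q1 by simp
    next
      case False
      then obtain m where n: "n = Suc m" "m > 0" using less.prems by (cases n) auto
      \<comment> \<open>The squaring identity one index lower expresses the unknown norm of
        \<open>Q n\<close> through known values.\<close>
      have eq: "L (Q m) = L (Q n * Q n) + L (Q (m - 1) * Q (m - 1))"
        using moment_square_orth_poly[of m] sq less.IH[of m] n by simp
      show ?thesis
      proof (cases "m = 1")
        case True
        then show ?thesis using eq Q1 by simp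
      next
        case False
        then have "L (Q 1 * Q m) = 0"
          using less.IH n by (intro orth_poly_orthogonal[of m]) auto
        moreover have "L (Q (m - 1) * Q (m - 1)) = 1"
          using less.IH[of "m - 1"] n False by simp
        ultimately show ?thesis using eq by (cases "L (Q n * Q n)") simp_all
      qed
    qed
  qed
  then show "\<forall>n>0. L (Q n * Q n) = 1" by blast
qed

end

theorem theorem1p5:
  fixes c :: "nat \<Rightarrow> int"
  assumes "zero_one_seq c"
    and "c 0 = 1"
  shows "apwenian c \<longleftrightarrow> (\<forall>n. [c n = c (2 * n + 1) + c (2 * n + 2)] (mod 2))"
proof -
  have "apwenian c \<longleftrightarrow> (\<forall>n\<ge>1. (of_int (hankel_det n c) :: bit) = 1)"
    using assms(1) by (simp add: apwenian_def bit_of_int_eq_1_iff)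
  also have "\<dots> \<longleftrightarrow> (\<forall>n. (of_int (c n) :: bit) = of_int (c (2 * n + 1)) + of_int (c (2 * n + 2)))"
    unfolding of_int_hankel_det
    by (rule hankel_dets_1_iff_recurrence) (simp add: assms(2))
  also have "\<dots> \<longleftrightarrow> (\<forall>n. [c n = c (2 * n + 1) + c (2 * n + 2)] (mod 2))"
    by (simp only: of_int_add[symmetric] bit_of_int_eq_iff)
  finally show ?thesis .
qed

end
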